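(* Let $\mathcal{C}$ be the unit circle centered at the origin of the $xy$-plane in $\mathbb{R}^3$, with constant density $\lambda>0$ and potential $V(\mathbf{r})=-\int_{\mathcal{C}}\frac{\lambda\,du}{\|\mathbf{r}-u\|}$. Let $\mathbf{r}(t)$ be a solution of $\ddot{\mathbf{r}}=-\nabla V(\mathbf{r})$ contained in the $xy$-plane and inside the circle (that is, $\|\mathbf{r}(t)\|<1$), with maximal interval of definition $(a,b)$. If $\mathbf{r}(t)$ approaches the circle (that is, $\operatorname{dist}(\mathbf{r}(t),\mathcal{C})\to 0$) as $t\to b^-$ or as $t\to a^+$, then: (1) $b<\infty$ or $-\infty<a$, respectively; hence $\mathbf{r}(t)$ converges to a point $p$ of the circle as $t\to b^-$ or as $t\to a^+$, respectively; (2) as $\mathbf{r}(t)$ converges to the circle, the speed $\|\dot{\mathbf{r}}(t)\|$ converges to $+\infty$ and the velocity $\dot{\mathbf{r}}(t)$ becomes orthogonal to the circle; that is, if $\tau$ is a unit tangent vector to $\mathcal{C}$ at the limit point $p$, then $\langle \dot{\mathbf{r}}(t),\tau\rangle/\|\dot{\mathbf{r}}(t)\|\to 0$.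
   Context: $du$ denotes arc length on $\mathcal{C}$, and $\operatorname{dist}$ is Euclidean distance. The $xy$-plane is invariant for the equation: a solution starting in it with velocity in it remains in it. *)

theory Defs
  imports "HOL-Analysis.Analysis"
begin

definition xy_plane :: "(real^3) set" where
  "xy_plane = {x. x $ 3 = 0}"

definition unit_circle :: "(real^3) set" where
  "unit_circle = sphere 0 1 \<inter> xy_plane"

definition circ :: "real \<Rightarrow> real^3" where
  "circ \<theta> = vector [cos \<theta>, sin \<theta>, 0]"

definition arc_length_integral ::
    "(real \<Rightarrow> 'a::real_normed_vector) \<Rightarrow> real \<Rightarrow> real \<Rightarrow> ('a \<Rightarrow> real) \<Rightarrow> real" where
  "arc_length_integral \<gamma> s t f =
     integral {s..t} (\<lambda>\<theta>. f (\<gamma> \<theta>) * norm (vector_derivative \<gamma> (at \<theta>)))"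

text \<open>On the circle itself the defining integral diverges, so the value given there by the
  convention for divergent integrals is meaningless; it is never used, because solutions of the
  equation of motion are required to avoid the circle, and the potential is differentiated
  only off this closed set.\<close>

definition potential :: "real \<Rightarrow> real^3 \<Rightarrow> real" where
  "potential lam x = - arc_length_integral circ 0 (2 * pi) (\<lambda>u. lam / norm (x - u))"

definition velocity :: "(real \<Rightarrow> real^3) \<Rightarrow> real \<Rightarrow> real^3" where
  "velocity r t = vector_derivative r (at t)"

definition solution_on :: "real \<Rightarrow> (real \<Rightarrow> real^3) \<Rightarrow> ereal \<Rightarrow> ereal \<Rightarrow> bool" where
  "solution_on lam r a b \<longleftrightarrow>
     (\<forall>t\<in>einterval a b. r t \<notin> unit_circle \<and> r differentiable (at t) \<and>
        (\<exists>g. (GDERIV (potential lam) (r t) :> g) \<and>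
             (velocity r has_vector_derivative - g) (at t)))"

text \<open>Only the values of a solution on its interval of definition matter: the function is
  total, and its values outside the interval are arbitrary.\<close>

definition maximal_solution :: "real \<Rightarrow> (real \<Rightarrow> real^3) \<Rightarrow> ereal \<Rightarrow> ereal \<Rightarrow> bool" where
  "maximal_solution lam r a b \<longleftrightarrow>
     a < b \<and> solution_on lam r a b \<and>
     (\<forall>q a' b'. a' \<le> a \<longrightarrow> b \<le> b' \<longrightarrow> solution_on lam q a' b' \<longrightarrow>
        (\<forall>t\<in>einterval a b. q t = r t) \<longrightarrow> a' = a \<and> b' = b)"

text \<open>One-sided limits of real time at a possibly infinite end point.\<close>

definition to_upper_end :: "ereal \<Rightarrow> real filter" where
  "to_upper_end b = filtercomap ereal (at_left b)"

definition to_lower_end :: "ereal \<Rightarrow> real filter" where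
  "to_lower_end a = filtercomap ereal (at_right a)"

definition unit_tangent :: "real^3 \<Rightarrow> real^3 \<Rightarrow> bool" where
  "unit_tangent p \<tau> \<longleftrightarrow> norm \<tau> = 1 \<and>
     (\<exists>\<theta> c. circ \<theta> = p \<and> \<tau> = c *\<^sub>R vector_derivative circ (at \<theta>))"

lemma filtercomap_filtermap_inj:
  assumes "inj f"
  shows "filtercomap f (filtermap f F) = F"
proof (rule antisym)
  show "filtercomap f (filtermap f F) \<le> F"
  proof (rule filter_leI)
    fix P assume "eventually P F"
    then have "eventually (\<lambda>y. \<forall>x. f x = y \<longrightarrow> P x) (filtermap f F)"
      using assms by (auto simp: eventually_filtermap inj_eq elim!: eventually_mono)
    then show "eventually P (filtercomap f (filtermap f F))"
      by (auto simp: eventually_filtercomap)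
  qed
qed (rule filtercomap_filtermap)

lemma to_upper_end_ereal: "to_upper_end (ereal b) = at_left b"
  and to_upper_end_PInf: "to_upper_end \<infinity> = at_top"
  and to_lower_end_ereal: "to_lower_end (ereal a) = at_right a"
  and to_lower_end_MInf: "to_lower_end (-\<infinity>) = at_bot"
  by (simp_all only: to_upper_end_def to_lower_end_def at_left_ereal at_right_ereal
      at_left_PInf at_right_MInf filtercomap_filtermap_inj[OF inj_ereal])

lemma has_vector_derivative_circ:
  "(circ has_vector_derivative vector [- sin \<theta>, cos \<theta>, 0]) (at \<theta>)"
  unfolding has_vector_derivative_def
proof (subst has_derivative_componentwise_within, intro ballI)
  fix e :: "real^3" assume "e \<in> Basis"
  then obtain i where e: "e = axis i 1"
    by (auto simp: Basis_vec_def)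
  have "((\<lambda>t. circ t $ i) has_real_derivative (vector [- sin \<theta>, cos \<theta>, 0] :: real^3) $ i) (at \<theta>)"
    using exhaust_3[of i]
    by (auto simp: circ_def intro!: derivative_eq_intros)
  then show "((\<lambda>t. circ t \<bullet> e) has_derivative
      (\<lambda>h. (h *\<^sub>R vector [- sin \<theta>, cos \<theta>, 0]) \<bullet> e)) (at \<theta>)"
    by (simp add: e inner_axis has_field_derivative_def mult_commute_abs)
qed

lemma arc_length_integral_circ:
  "arc_length_integral circ s t f = integral {s..t} (\<lambda>\<theta>. f (circ \<theta>))"
proof -
  have "norm (vector_derivative circ (at \<theta>)) = 1" for \<theta>
    unfolding vector_derivative_at[OF has_vector_derivative_circ]
    by (simp add: norm_vec_def L2_set_def sum_3)
  then show ?thesis by (simp add: arc_length_integral_def)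
qed

lemma circ_image: "circ ` {0..2 * pi} = unit_circle"
proof (intro set_eqI iffI)
  fix x assume "x \<in> circ ` {0..2 * pi}"
  then show "x \<in> unit_circle"
    by (auto simp: circ_def unit_circle_def xy_plane_def norm_vec_def L2_set_def sum_3)
next
  fix x :: "real^3" assume x: "x \<in> unit_circle"
  then have 1: "(x $ 1)\<^sup>2 + (x $ 2)\<^sup>2 = 1" and 2: "x $ 3 = 0"
    by (auto simp: unit_circle_def xy_plane_def norm_vec_def L2_set_def sum_3)
  obtain t where "0 \<le> t" "t < 2 * pi" "x $ 1 = cos t" "x $ 2 = sin t"
    using sincos_total_2pi[OF 1] by metis
  then have "x = circ t" "t \<in> {0..2 * pi}"
    using 2 by (auto simp: circ_def vec_eq_iff forall_3)
  then show "x \<in> circ ` {0..2 * pi}" by blast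
qed

end

theory Submission
  imports Defs
begin

text \<open>
  In the disk the motion is governed by a potential \<open>V\<close> that is rotationally symmetric and
  tends to \<open>-\<infinity>\<close> at the circle, so the two classical integrals of a central force decide everything.

  \<^item> Rotating \<open>x\<close> about the \<open>z\<close>-axis merely shifts the parameter of the circle in the integral for
    \<open>V(x)\<close> (\<open>potential_rotate_xy\<close>). Differentiating this invariance at the identity shows that
    \<open>\<nabla>V(x)\<close> is orthogonal to the quarter turn \<open>Jx\<close>, whence the angular momentum
    \<open>c = \<langle>v, Jr\<rangle>\<close> is constant. The energy \<open>\<parallel>v\<parallel>\<^sup>2/2 + V(r)\<close> is constant as for any gradient field.

  \<^item> Comparing the integrand with \<open>\<lambda>/(1 - \<parallel>x\<parallel> + \<theta>)\<close> on an arc of length one next to the nearest point of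
    the circle gives \<open>V(x) \<le> \<lambda> ln (1 - \<parallel>x\<parallel>)\<close> (\<open>potential_le_ln\<close>). By conservation of energy the
    speed tends to infinity.

  \<^item> In the plane, \<open>\<langle>r,v\<rangle>\<^sup>2 = \<parallel>r\<parallel>\<^sup>2\<parallel>v\<parallel>\<^sup>2 - c\<^sup>2\<close>. Hence the derivative \<open>2\<langle>r,v\<rangle>\<close> of \<open>\<parallel>r\<parallel>\<^sup>2\<close> becomes
    unbounded although \<open>\<parallel>r\<parallel>\<^sup>2\<close> stays in \<open>[0,1]\<close>, and the mean value theorem bounds the remaining time
    (\<open>short_if_radial_speed_ge_1\<close>).

  \<^item> The direction \<open>r/\<parallel>r\<parallel>\<close> turns with angular velocity \<open>c/\<parallel>r\<parallel>\<^sup>2\<close>, which is bounded near the circle.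
    It is thus Lipschitz in time, and over a finite remaining time it converges; so does \<open>r\<close>
    (\<open>position_converges\<close>).

  \<^item> At the limit point \<open>p\<close> the tangent direction is \<open>Jp\<close>, and
    \<open>\<langle>v,Jp\<rangle> = c + \<langle>v,J(p - r)\<rangle>\<close>, which divided by the speed tends to zero
    (\<open>velocity_becomes_orthogonal\<close>).

  The limits are taken along an arbitrary filter of times at which the orbit approaches the circle,
  so that they serve the upper and the lower end of the time interval alike.
\<close>

section \<open>Rotational symmetry of the potential\<close>

lemma integral_periodic_shift:
  fixes f :: "real \<Rightarrow> 'a::banach"
  assumes cont: "continuous_on UNIV f" and per: "\<And>\<theta>. f (\<theta> + p) = f \<theta>"
    and s: "0 \<le> s" "s \<le> p"
  shows "integral {0..p} (\<lambda>\<theta>. f (\<theta> + s)) = integral {0..p} f"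
proof -
  have int: "f integrable_on {x..y}" for x y
    using cont by (intro integrable_continuous_interval) (auto intro: continuous_on_subset)
  have shift: "integral {x..y} (\<lambda>\<theta>. f (\<theta> + c)) = integral {x + c..y + c} f" for x y c
    using integral_shift_real_ivl[of "x + c" c "y + c" f] by simp
  have "integral {0..p} (\<lambda>\<theta>. f (\<theta> + s)) = integral {s..p + s} f"
    using shift[of 0 p s] by simp
  also have "\<dots> = integral {s..p} f + integral {p..p + s} f"
    using s int by (intro Henstock_Kurzweil_Integration.integral_combine[symmetric]) auto
  also have "integral {p..p + s} f = integral {0..s} f"
    using shift[of 0 s p] by (simp add: per add.commute)
  also have "integral {s..p} f + integral {0..s} f = integral {0..p} f"
    using s int Henstock_Kurzweil_Integration.integral_combine[of 0 s p f]
    by (simp add: add.commute)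
  finally show ?thesis .
qed

definition rotate_xy :: "real \<Rightarrow> real^3 \<Rightarrow> real^3" where
  "rotate_xy s x = vector [cos s * x $ 1 - sin s * x $ 2, sin s * x $ 1 + cos s * x $ 2, x $ 3]"

text \<open>
  The infinitesimal generator of the rotations: for planar \<open>x\<close> it is the rotation by a right angle,
  and it annihilates the \<open>z\<close>-direction.\<close>

definition quarter_turn :: "real^3 \<Rightarrow> real^3" where
  "quarter_turn x = vector [- x $ 2, x $ 1, 0]"

lemma inner_vec3: "x \<bullet> y = x $ 1 * y $ 1 + x $ 2 * y $ 2 + x $ 3 * y $ 3" for x y :: "real^3"
  by (simp add: inner_vec_def sum_3)

lemma norm_vec3_squared: "(norm x)\<^sup>2 = (x $ 1)\<^sup>2 + (x $ 2)\<^sup>2 + (x $ 3)\<^sup>2" for x :: "real^3"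
  unfolding power2_norm_eq_inner by (simp add: inner_vec3 power2_eq_square)

lemma rotate_xy_diff: "rotate_xy s (x - y) = rotate_xy s x - rotate_xy s y"
  by (simp add: rotate_xy_def vec_eq_iff forall_3 algebra_simps)

lemma norm_rotate_xy: "norm (rotate_xy s x) = norm x"
proof -
  have "(norm (rotate_xy s x))\<^sup>2
      = ((cos s)\<^sup>2 + (sin s)\<^sup>2) * ((x $ 1)\<^sup>2 + (x $ 2)\<^sup>2) + (x $ 3)\<^sup>2"
    unfolding norm_vec3_squared rotate_xy_def by (simp only: vector_3) algebra
  also have "\<dots> = (norm x)\<^sup>2"
    by (simp add: norm_vec3_squared)
  finally show ?thesis
    by simp
qed

lemma rotate_xy_circ: "rotate_xy s (circ \<theta>) = circ (\<theta> + s)"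
  by (simp add: rotate_xy_def circ_def vec_eq_iff forall_3 cos_add sin_add algebra_simps)

lemma circ_in_unit_circle: "circ \<theta> \<in> unit_circle"
  by (simp add: circ_def unit_circle_def xy_plane_def norm_vec_def L2_set_def sum_3)

lemma continuous_on_circ: "continuous_on S circ"
  by (meson continuous_at_imp_continuous_on has_vector_derivative_circ
      has_vector_derivative_continuous)

lemma potential_eq:
  "potential lam x = - integral {0..2 * pi} (\<lambda>\<theta>. lam / norm (x - circ \<theta>))"
  by (simp add: potential_def arc_length_integral_circ)

lemma continuous_on_potential_integrand:
  assumes "x \<notin> unit_circle"
  shows "continuous_on S (\<lambda>\<theta>. lam / norm (x - circ \<theta>))"
  using assms circ_in_unit_circle by (intro continuous_intros continuous_on_circ) auto

lemma rotate_xy_unit_circle: "rotate_xy s x \<in> unit_circle \<longleftrightarrow> x \<in> unit_circle"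
  by (simp add: unit_circle_def norm_rotate_xy) (simp add: xy_plane_def rotate_xy_def)

text \<open>Rotations map the circle to itself and preserve distances, so the rotated integrand is a shift of
  the original one by the angle of rotation.\<close>

lemma potential_rotate_xy:
  assumes "x \<notin> unit_circle"
  shows "potential lam (rotate_xy s x) = potential lam x"
proof -
  \<comment> \<open>Only the rotation matters, so the angle may be taken in one period.\<close>
  obtain t where t: "0 \<le> t" "t < 2 * pi" "cos s = cos t" "sin s = sin t"
    using sincos_total_2pi[of "cos s" "sin s"] by auto
  define f where "f \<theta> = lam / norm (rotate_xy t x - circ \<theta>)" for \<theta>
  have "rotate_xy s x = rotate_xy t x"
    by (simp add: rotate_xy_def t)
  moreover have "integral {0..2 * pi} (\<lambda>\<theta>. f (\<theta> + t)) = integral {0..2 * pi} f"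
    using t assms unfolding f_def
    by (intro integral_periodic_shift continuous_on_potential_integrand)
       (auto simp: rotate_xy_unit_circle circ_def)
  moreover have "f (\<theta> + t) = lam / norm (x - circ \<theta>)" for \<theta>
    unfolding f_def rotate_xy_circ[symmetric] rotate_xy_diff[symmetric] norm_rotate_xy ..
  ultimately show ?thesis
    by (simp add: potential_eq flip: f_def)
qed

lemma has_vector_derivative_rotate_xy:
  "((\<lambda>s. rotate_xy s x) has_vector_derivative quarter_turn x) (at 0)"
  unfolding has_vector_derivative_def
proof (subst has_derivative_componentwise_within, intro ballI)
  fix e :: "real^3" assume "e \<in> Basis"
  then obtain i where e: "e = axis i 1"
    by (auto simp: Basis_vec_def)
  have "((\<lambda>s. rotate_xy s x $ i) has_real_derivative quarter_turn x $ i) (at 0)"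
    using exhaust_3[of i]
    by (auto simp: rotate_xy_def quarter_turn_def intro!: derivative_eq_intros)
  then show "((\<lambda>s. rotate_xy s x \<bullet> e) has_derivative (\<lambda>h. (h *\<^sub>R quarter_turn x) \<bullet> e)) (at 0)"
    by (simp add: e inner_axis has_field_derivative_def mult_commute_abs)
qed

lemma GDERIV_compose_vector_derivative:
  assumes "GDERIV f (\<gamma> t) :> g" and "(\<gamma> has_vector_derivative v) (at t)"
  shows "((\<lambda>s. f (\<gamma> s)) has_real_derivative v \<bullet> g) (at t)"
proof -
  have "((\<lambda>s. f (\<gamma> s)) has_derivative (\<lambda>h. (h *\<^sub>R v) \<bullet> g)) (at t)"
    using assms unfolding gderiv_def has_vector_derivative_def
    by (rule has_derivative_compose[rotated])
  then show ?thesis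
    by (simp add: has_field_derivative_def mult_commute_abs)
qed

text \<open>The potential is constant along the orbit of \<open>x\<close> under rotations, and \<open>quarter_turn x\<close> is the
  velocity of that orbit at \<open>x\<close>.\<close>

lemma gradient_potential_orthogonal_quarter_turn:
  assumes "GDERIV (potential lam) x :> g" and "x \<notin> unit_circle"
  shows "g \<bullet> quarter_turn x = 0"
proof -
  have x: "rotate_xy 0 x = x"
    by (simp add: rotate_xy_def vec_eq_iff forall_3)
  have "((\<lambda>s. potential lam (rotate_xy s x)) has_real_derivative quarter_turn x \<bullet> g) (at 0)"
    using assms(1) x
    by (intro GDERIV_compose_vector_derivative has_vector_derivative_rotate_xy) simp
  moreover have "((\<lambda>s. potential lam (rotate_xy s x)) has_real_derivative 0) (at 0)"
    by (simp add: potential_rotate_xy[OF assms(2)])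
  ultimately show ?thesis
    using DERIV_unique by (metis inner_commute)
qed

section \<open>The logarithmic singularity at the circle\<close>

lemma norm_circ_diff_le: "norm (circ \<theta> - circ \<phi>) \<le> \<bar>\<theta> - \<phi>\<bar>"
proof -
  have "onorm (\<lambda>h. h *\<^sub>R vector [- sin t, cos t, 0] :: real^3) \<le> 1" for t :: real
  proof (rule onorm_le)
    have "norm (vector [- sin t, cos t, 0] :: real^3) = 1"
      by (simp add: norm_vec_def L2_set_def sum_3)
    then show "norm (h *\<^sub>R (vector [- sin t, cos t, 0] :: real^3)) \<le> 1 * norm h" for h
      by simp
  qed
  then have "norm (circ \<theta> - circ \<phi>) \<le> 1 * norm (\<theta> - \<phi>)"
    by (intro differentiable_bound[where S=UNIV
          and f'="\<lambda>t h. h *\<^sub>R vector [- sin t, cos t, 0]"])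
       (use has_vector_derivative_circ in \<open>auto simp: has_vector_derivative_def\<close>)
  then show ?thesis by simp
qed

text \<open>By symmetry the point may be placed at \<open>(\<rho>, 0, 0)\<close>. Its distance to \<open>circ \<theta>\<close> is at most
  \<open>1 - \<rho> + \<theta>\<close>, through the point \<open>circ 0\<close>, and integrating the reciprocal over \<open>0 \<le> \<theta> \<le> 1\<close> produces
  the logarithm; the rest of the circle only adds to the attraction.\<close>

lemma potential_le_ln:
  assumes "lam \<ge> 0" and "x \<in> xy_plane" and "norm x < 1"
  shows "potential lam x \<le> lam * ln (1 - norm x)"
proof -
  define \<rho> where "\<rho> = norm x"
  have \<rho>: "0 \<le> \<rho>" "\<rho> < 1"
    using assms by (auto simp: \<rho>_def)
  define y where "y = \<rho> *\<^sub>R circ 0"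
  have y: "y \<notin> unit_circle"
    using \<rho> circ_in_unit_circle[of 0] by (simp add: y_def unit_circle_def)
  obtain s where s: "x = rotate_xy s y"
  proof (cases "x = 0")
    case True
    then show ?thesis
      using that[of 0] by (simp add: y_def \<rho>_def rotate_xy_def vec_eq_iff forall_3)
  next
    case False
    then have "(1 / \<rho>) *\<^sub>R x \<in> unit_circle"
      using assms by (simp add: \<rho>_def unit_circle_def xy_plane_def)
    then obtain s where "circ s = (1 / \<rho>) *\<^sub>R x"
      using circ_image by (metis imageE)
    then have "x = \<rho> *\<^sub>R circ s"
      using False by (simp add: \<rho>_def)
    then show ?thesis
      using that[of s] by (simp add: y_def circ_def rotate_xy_def vec_eq_iff forall_3)
  qed
  define F where "F \<theta> = lam * ln (1 - \<rho> + \<theta>)" for \<theta>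
  have "((\<lambda>\<theta>. lam / (1 - \<rho> + \<theta>)) has_integral F 1 - F 0) {0..1}"
    using \<rho>
    by (intro fundamental_theorem_of_calculus)
       (auto simp: F_def has_real_derivative_iff_has_vector_derivative[symmetric]
          intro!: derivative_eq_intros)
  then have "F 1 - F 0 \<le> integral {0..1} (\<lambda>\<theta>. lam / norm (y - circ \<theta>))"
  proof (rule has_integral_le)
    show "((\<lambda>\<theta>. lam / norm (y - circ \<theta>)) has_integral
        integral {0..1} (\<lambda>\<theta>. lam / norm (y - circ \<theta>))) {0..1}"
      by (intro integrable_integral integrable_continuous_interval
          continuous_on_potential_integrand y)
  next
    fix \<theta> :: real assume \<theta>: "\<theta> \<in> {0..1}"
    have "norm (y - circ \<theta>) \<le> norm (y - circ 0) + norm (circ 0 - circ \<theta>)"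
      using norm_triangle_ineq[of "y - circ 0" "circ 0 - circ \<theta>"] by simp
    also have "norm (y - circ 0) = 1 - \<rho>"
    proof -
      have "y - circ 0 = (\<rho> - 1) *\<^sub>R circ 0"
        by (simp add: y_def algebra_simps)
      then show ?thesis
        using \<rho> circ_in_unit_circle[of 0] by (simp add: unit_circle_def)
    qed
    also have "norm (circ 0 - circ \<theta>) \<le> \<theta>"
      using norm_circ_diff_le[of 0 \<theta>] \<theta> by simp
    finally have "norm (y - circ \<theta>) \<le> 1 - \<rho> + \<theta>"
      by simp
    moreover have "0 < norm (y - circ \<theta>)"
      using y circ_in_unit_circle by auto
    ultimately show "lam / (1 - \<rho> + \<theta>) \<le> lam / norm (y - circ \<theta>)"
      using \<open>lam \<ge> 0\<close> \<rho> \<theta> by (intro divide_left_mono mult_pos_pos) auto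
  qed
  also have "\<dots> \<le> integral {0..2 * pi} (\<lambda>\<theta>. lam / norm (y - circ \<theta>))"
    using pi_gt3 \<open>lam \<ge> 0\<close>
    by (intro integral_subset_le integrable_continuous_interval
        continuous_on_potential_integrand y) auto
  finally have "potential lam y \<le> F 0 - F 1"
    by (simp add: potential_eq)
  also have "\<dots> \<le> F 0"
    using \<rho> \<open>lam \<ge> 0\<close> by (simp add: F_def)
  finally show ?thesis
    using potential_rotate_xy[OF y, of lam s] s by (simp add: F_def \<rho>_def)
qed

lemma infdist_unit_circle_ge: "1 - norm x \<le> infdist x unit_circle"
proof -
  have ne: "unit_circle \<noteq> {}"
    using circ_in_unit_circle by blast
  have "1 - norm x \<le> dist x u" if "u \<in> unit_circle" for u
    using that norm_triangle_ineq2[of u x]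
    by (simp add: unit_circle_def dist_norm norm_minus_commute)
  then show ?thesis
    unfolding infdist_notempty[OF ne] using ne by (intro cINF_greatest) auto
qed

section \<open>Conservation laws for planar orbits\<close>

lemma inner_quarter_turn_self: "x \<bullet> quarter_turn x = 0"
  by (simp add: inner_vec3 quarter_turn_def)

lemma bounded_linear_quarter_turn: "bounded_linear quarter_turn"
  unfolding linear_conv_bounded_linear[symmetric]
  by (intro linearI) (simp_all add: quarter_turn_def vec_eq_iff forall_3)

lemma norm_quarter_turn_le: "norm (quarter_turn x) \<le> norm x"
  by (rule power2_le_imp_le) (simp_all add: norm_vec3_squared quarter_turn_def)

lemma planar_lagrange_identity:
  assumes "x \<in> xy_plane" "v \<in> xy_plane"
  shows "(x \<bullet> v)\<^sup>2 + (v \<bullet> quarter_turn x)\<^sup>2 = (norm x)\<^sup>2 * (norm v)\<^sup>2"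
proof -
  have z: "x $ 3 = 0" "v $ 3 = 0"
    using assms by (simp_all add: xy_plane_def)
  show ?thesis
    unfolding norm_vec3_squared inner_vec3 quarter_turn_def vector_3 z
    by (simp only: zero_power2 mult_zero_right add_0_right) algebra
qed

text \<open>For \<open>x \<noteq> 0\<close>, the vectors \<open>x\<close> and \<open>quarter_turn x\<close> form an orthogonal basis of the plane, both of
  length \<open>norm x\<close>.\<close>

lemma planar_decomposition:
  assumes "x \<in> xy_plane" "v \<in> xy_plane"
  shows "(norm x)\<^sup>2 *\<^sub>R v = (x \<bullet> v) *\<^sub>R x + (v \<bullet> quarter_turn x) *\<^sub>R quarter_turn x"
proof -
  have z: "x $ 3 = 0" "v $ 3 = 0"
    using assms by (simp_all add: xy_plane_def)
  show ?thesis
    unfolding vec_eq_iff forall_3 norm_vec3_squared inner_vec3 quarter_turn_def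
      vector_add_component vector_scaleR_component real_scaleR_def vector_3 z
    by (simp only: zero_power2 mult_zero_right add_0_right) algebra
qed

lemma is_interval_einterval: "is_interval (einterval c d)"
  unfolding is_interval_1
proof (intro ballI allI impI)
  fix s t x assume "s \<in> einterval c d" "t \<in> einterval c d" and x: "s \<le> x \<and> x \<le> t"
  then have "c < ereal s" "ereal t < d"
    by (simp_all add: einterval_iff)
  moreover have "ereal s \<le> ereal x" "ereal x \<le> ereal t"
    using x by simp_all
  ultimately show "x \<in> einterval c d"
    unfolding einterval_iff by (meson order.strict_trans1 order.strict_trans2)
qed

locale planar_orbit =
  fixes lam :: real and r :: "real \<Rightarrow> real^3" and a b :: ereal
  assumes lam_pos: "0 < lam"
    and solution: "solution_on lam r a b"
    and inside: "t \<in> einterval a b \<Longrightarrow> r t \<in> xy_plane \<and> norm (r t) < 1"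
begin

lemma has_velocity:
  "t \<in> einterval a b \<Longrightarrow> (r has_vector_derivative velocity r t) (at t)"
  using solution by (simp add: solution_on_def velocity_def vector_derivative_works)

lemma acceleration:
  assumes "t \<in> einterval a b"
  shows "\<exists>g. GDERIV (potential lam) (r t) :> g \<and>
     (velocity r has_vector_derivative - g) (at t) \<and> g \<bullet> quarter_turn (r t) = 0"
proof -
  obtain g where g: "GDERIV (potential lam) (r t) :> g"
    "(velocity r has_vector_derivative - g) (at t)" and "r t \<notin> unit_circle"
    using solution assms unfolding solution_on_def by blast
  then show ?thesis
    using gradient_potential_orthogonal_quarter_turn by blast
qed

text \<open>The third coordinate of the orbit vanishes on an open set of times.\<close>

lemma velocity_in_xy_plane:
  assumes t: "t \<in> einterval a b"
  shows "velocity r t \<in> xy_plane"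
proof -
  have "((\<lambda>s. r s $ 3) has_vector_derivative velocity r t $ 3) (at t)"
    using has_velocity[OF t] by (rule bounded_linear.has_vector_derivative[OF bounded_linear_vec_nth])
  moreover have "((\<lambda>s. r s $ 3) has_vector_derivative 0) (at t)"
  proof (rule has_vector_derivative_transform_within_open)
    show "((\<lambda>s. 0) has_vector_derivative 0) (at t)"
      by (rule has_vector_derivative_const)
    show "0 = r s $ 3" if "s \<in> einterval a b" for s
      using inside[OF that] by (simp add: xy_plane_def)
  qed (use t in auto)
  ultimately show ?thesis
    unfolding xy_plane_def mem_Collect_eq by (rule vector_derivative_unique_at)
qed

lemma constant_if_zero_derivative:
  fixes f :: "real \<Rightarrow> real"
  assumes "\<And>t. t \<in> einterval a b \<Longrightarrow> (f has_real_derivative 0) (at t)"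
  shows "\<exists>c. \<forall>t\<in>einterval a b. f t = c"
proof (rule has_field_derivative_zero_constant)
  show "convex (einterval a b)"
    by (rule is_interval_convex[OF is_interval_einterval])
  show "(f has_real_derivative 0) (at t within einterval a b)" if "t \<in> einterval a b" for t
    using assms[OF that] by (rule has_field_derivative_at_within)
qed

text \<open>Of the two terms of the derivative, the one with the acceleration vanishes because the force is
  radial, and the one with the velocity because \<open>quarter_turn v\<close> is orthogonal to \<open>v\<close>.\<close>

lemma angular_momentum_conserved:
  "\<exists>c. \<forall>t\<in>einterval a b. velocity r t \<bullet> quarter_turn (r t) = c"
proof (rule constant_if_zero_derivative)
  fix t assume t: "t \<in> einterval a b"
  obtain g where g: "(velocity r has_vector_derivative - g) (at t)" "g \<bullet> quarter_turn (r t) = 0"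
    using acceleration[OF t] by blast
  have "((\<lambda>t. quarter_turn (r t)) has_vector_derivative quarter_turn (velocity r t)) (at t)"
    by (rule bounded_linear.has_vector_derivative[OF bounded_linear_quarter_turn has_velocity[OF t]])
  from bounded_bilinear.has_vector_derivative[OF bounded_bilinear_inner g(1) this]
  show "((\<lambda>t. velocity r t \<bullet> quarter_turn (r t)) has_real_derivative 0) (at t)"
    using g(2) by (simp add: has_real_derivative_iff_has_vector_derivative inner_quarter_turn_self)
qed

lemma energy_conserved:
  "\<exists>E. \<forall>t\<in>einterval a b. (norm (velocity r t))\<^sup>2 / 2 + potential lam (r t) = E"
proof (rule constant_if_zero_derivative)
  fix t assume t: "t \<in> einterval a b"
  obtain g where g: "GDERIV (potential lam) (r t) :> g"
    "(velocity r has_vector_derivative - g) (at t)"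
    using acceleration[OF t] by blast
  have "((\<lambda>t. velocity r t \<bullet> velocity r t) has_real_derivative - 2 * (velocity r t \<bullet> g)) (at t)"
    using bounded_bilinear.has_vector_derivative[OF bounded_bilinear_inner g(2) g(2)]
    by (simp add: has_real_derivative_iff_has_vector_derivative inner_commute)
  moreover have "((\<lambda>t. potential lam (r t)) has_real_derivative velocity r t \<bullet> g) (at t)"
    by (rule GDERIV_compose_vector_derivative[OF g(1) has_velocity[OF t]])
  ultimately show "((\<lambda>t. (norm (velocity r t))\<^sup>2 / 2 + potential lam (r t))
      has_real_derivative 0) (at t)"
    unfolding power2_norm_eq_inner by (auto intro!: derivative_eq_intros)
qed

lemma has_derivative_norm_squared:
  assumes "t \<in> einterval a b"
  shows "((\<lambda>t. (norm (r t))\<^sup>2) has_real_derivative 2 * (r t \<bullet> velocity r t)) (at t)"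
  unfolding power2_norm_eq_inner has_real_derivative_iff_has_vector_derivative
  using bounded_bilinear.has_vector_derivative[OF bounded_bilinear_inner
      has_velocity[OF assms] has_velocity[OF assms]]
  by (simp add: inner_commute)

text \<open>The radial part of the velocity cancels, and what remains is a rotation with angular velocity
  \<open>c / (norm (r t))\<^sup>2\<close>, where \<open>c\<close> is the angular momentum.\<close>

lemma has_derivative_direction:
  assumes t: "t \<in> einterval a b" and "r t \<noteq> 0"
  shows "((\<lambda>t. sgn (r t)) has_vector_derivative
     ((velocity r t \<bullet> quarter_turn (r t)) / norm (r t) ^ 3) *\<^sub>R quarter_turn (r t)) (at t)"
proof -
  define n where "n = norm (r t)"
  define v where "v = velocity r t"
  have n: "n \<noteq> 0"
    using assms by (simp add: n_def)
  have "((\<lambda>t. norm (r t)) has_real_derivative v \<bullet> sgn (r t)) (at t)"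
    unfolding v_def using GDERIV_norm[OF \<open>r t \<noteq> 0\<close>] has_velocity[OF t]
    by (rule GDERIV_compose_vector_derivative)
  then have "((\<lambda>t. inverse (norm (r t))) has_real_derivative - ((r t \<bullet> v) / n ^ 3)) (at t)"
    using n by (auto intro!: derivative_eq_intros simp: sgn_div_norm n_def inner_commute
        field_simps power2_eq_square power3_eq_cube)
  from has_vector_derivative_scaleR[OF this has_velocity[OF t]]
  have "((\<lambda>t. sgn (r t)) has_vector_derivative
      inverse n *\<^sub>R v - ((r t \<bullet> v) / n ^ 3) *\<^sub>R r t) (at t)"
    by (simp add: sgn_div_norm n_def v_def)
  also have "inverse n *\<^sub>R v = (1 / n ^ 3) *\<^sub>R (n\<^sup>2 *\<^sub>R v)"
    using n by (simp add: power2_eq_square power3_eq_cube field_simps)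
  also have "n\<^sup>2 *\<^sub>R v = (r t \<bullet> v) *\<^sub>R r t + (v \<bullet> quarter_turn (r t)) *\<^sub>R quarter_turn (r t)"
    unfolding n_def v_def using inside[OF t] velocity_in_xy_plane[OF t]
    by (intro planar_decomposition) auto
  finally show ?thesis
    by (simp add: n_def v_def algebra_simps)
qed

section \<open>Approach to the circle\<close>

lemma norm_tendsto_1:
  assumes ev: "\<forall>\<^sub>F t in F. t \<in> einterval a b"
    and lim: "((\<lambda>t. infdist (r t) unit_circle) \<longlongrightarrow> 0) F"
  shows "((\<lambda>t. norm (r t)) \<longlongrightarrow> 1) F"
proof (rule tendsto_sandwich)
  show "\<forall>\<^sub>F t in F. 1 - infdist (r t) unit_circle \<le> norm (r t)"
    using infdist_unit_circle_ge by (intro always_eventually) (simp add: diff_le_eq add.commute)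
  show "\<forall>\<^sub>F t in F. norm (r t) \<le> 1"
    using ev by eventually_elim (use inside in fastforce)
  show "((\<lambda>t. 1 - infdist (r t) unit_circle) \<longlongrightarrow> 1) F"
    using tendsto_diff[OF tendsto_const lim, of 1] by simp
qed simp

text \<open>The kinetic energy is the constant total energy minus the potential, and the latter is at most a
  multiple of a logarithm that tends to \<open>-\<infinity>\<close>.\<close>

lemma speed_at_top:
  assumes ev: "\<forall>\<^sub>F t in F. t \<in> einterval a b"
    and lim: "((\<lambda>t. norm (r t)) \<longlongrightarrow> 1) F"
  shows "filterlim (\<lambda>t. norm (velocity r t)) at_top F"
proof -
  obtain E where E: "\<And>t. t \<in> einterval a b \<Longrightarrow>
      (norm (velocity r t))\<^sup>2 / 2 + potential lam (r t) = E"
    using energy_conserved by blast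
  have "filterlim (\<lambda>t. 1 - norm (r t)) (at_right 0) F"
    unfolding filterlim_at
  proof
    show "\<forall>\<^sub>F t in F. 1 - norm (r t) \<in> {0<..} \<and> 1 - norm (r t) \<noteq> 0"
      using ev by eventually_elim (use inside in fastforce)
    show "((\<lambda>t. 1 - norm (r t)) \<longlongrightarrow> 0) F"
      using tendsto_diff[OF tendsto_const lim, of 1] by simp
  qed
  then have "filterlim (\<lambda>t. ln (1 - norm (r t))) at_bot F"
    by (rule filterlim_compose[OF ln_at_0])
  then have "filterlim (\<lambda>t. - ln (1 - norm (r t))) at_top F"
    by (simp add: filterlim_uminus_at_top)
  then have "filterlim (\<lambda>t. (2 * lam) * - ln (1 - norm (r t))) at_top F"
    using lam_pos by (intro filterlim_tendsto_pos_mult_at_top[OF tendsto_const]) auto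
  then have *: "filterlim (\<lambda>t. 2 * E + (2 * lam) * - ln (1 - norm (r t))) at_top F"
    by (rule filterlim_tendsto_add_at_top[OF tendsto_const])
  have "filterlim (\<lambda>t. (norm (velocity r t))\<^sup>2) at_top F"
  proof (rule filterlim_at_top_mono[OF *])
    show "\<forall>\<^sub>F t in F. 2 * E + (2 * lam) * - ln (1 - norm (r t)) \<le> (norm (velocity r t))\<^sup>2"
      using ev
    proof eventually_elim
      case (elim t)
      have "potential lam (r t) \<le> lam * ln (1 - norm (r t))"
        using lam_pos inside[OF elim] by (intro potential_le_ln) auto
      with E[OF elim] show ?case
        by (simp add: field_simps)
    qed
  qed
  from filterlim_compose[OF sqrt_at_top this] show ?thesis
    by simp
qed

text \<open>The constant angular momentum keeps the tangential part of the velocity bounded near the circle, so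
  the growth of the speed is due to the radial part.\<close>

lemma radial_speed_at_top:
  assumes ev: "\<forall>\<^sub>F t in F. t \<in> einterval a b"
    and lim: "((\<lambda>t. norm (r t)) \<longlongrightarrow> 1) F"
  shows "filterlim (\<lambda>t. (r t \<bullet> velocity r t)\<^sup>2) at_top F"
proof -
  obtain c where c: "\<And>t. t \<in> einterval a b \<Longrightarrow> velocity r t \<bullet> quarter_turn (r t) = c"
    using angular_momentum_conserved by blast
  have "((\<lambda>t. (norm (r t))\<^sup>2) \<longlongrightarrow> 1) F"
    using tendsto_power[OF lim, of 2] by simp
  moreover have "filterlim (\<lambda>t. (norm (velocity r t))\<^sup>2) at_top F"
    by (rule filterlim_pow_at_top) (use speed_at_top[OF ev lim] in auto)
  ultimately have "filterlim (\<lambda>t. (norm (r t))\<^sup>2 * (norm (velocity r t))\<^sup>2) at_top F"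
    by (intro filterlim_tendsto_pos_mult_at_top) auto
  then have *: "filterlim (\<lambda>t. - c\<^sup>2 + (norm (r t))\<^sup>2 * (norm (velocity r t))\<^sup>2) at_top F"
    by (rule filterlim_tendsto_add_at_top[OF tendsto_const])
  have "\<forall>\<^sub>F t in F. - c\<^sup>2 + (norm (r t))\<^sup>2 * (norm (velocity r t))\<^sup>2 = (r t \<bullet> velocity r t)\<^sup>2"
    using ev
  proof eventually_elim
    case (elim t)
    show ?case
      using planar_lagrange_identity[of "r t" "velocity r t"] c[OF elim] inside[OF elim]
        velocity_in_xy_plane[OF elim] by simp
  qed
  with * show ?thesis
    by (rule filterlim_cong[OF refl refl, THEN iffD1, rotated])
qed

text \<open>The function \<open>(norm (r t))\<^sup>2\<close> varies by at most 1 but has a derivative of modulus at least 2. This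
  bounds the time that remains before the circle is reached.\<close>

lemma short_if_radial_speed_ge_1:
  assumes S: "is_interval S" "S \<subseteq> einterval a b"
    and fast: "\<And>t. t \<in> S \<Longrightarrow> 1 \<le> (r t \<bullet> velocity r t)\<^sup>2"
    and st: "s \<in> S" "t \<in> S"
  shows "t - s < 1"
proof (rule ccontr)
  assume "\<not> t - s < 1"
  then have "s < t" "1 \<le> t - s"
    by auto
  have sub: "x \<in> S" if "s \<le> x" "x \<le> t" for x
    using S(1) st that by (meson is_interval_1)
  have "((\<lambda>t. (norm (r t))\<^sup>2) has_real_derivative 2 * (r x \<bullet> velocity r x)) (at x)"
    if "s \<le> x" "x \<le> t" for x
    using has_derivative_norm_squared sub[OF that] S(2) by blast
  from MVT2[OF \<open>s < t\<close> this] obtain x where x: "s < x" "x < t"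
    "(norm (r t))\<^sup>2 - (norm (r s))\<^sup>2 = (t - s) * (2 * (r x \<bullet> velocity r x))"
    by blast
  have "1 \<le> \<bar>r x \<bullet> velocity r x\<bar>"
    using fast[OF sub[of x]] x abs_le_square_iff[of 1 "r x \<bullet> velocity r x"] by simp
  then have "1 * 2 \<le> (t - s) * (2 * \<bar>r x \<bullet> velocity r x\<bar>)"
    using \<open>1 \<le> t - s\<close> by (intro mult_mono) auto
  also have "\<dots> = \<bar>(norm (r t))\<^sup>2 - (norm (r s))\<^sup>2\<bar>"
    unfolding x(3) using \<open>s < t\<close> by (simp add: abs_mult)
  finally have "2 \<le> \<bar>(norm (r t))\<^sup>2 - (norm (r s))\<^sup>2\<bar>"
    by simp
  moreover have le1: "0 \<le> (norm (r y))\<^sup>2 \<and> (norm (r y))\<^sup>2 \<le> 1" if "y \<in> S" for y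
    using inside[of y] that S(2) by (auto intro!: power_le_one)
  ultimately show False
    using le1[OF st(1)] le1[OF st(2)] by linarith
qed

text \<open>Near the circle the angular velocity is bounded, so the direction is Lipschitz on \<open>S\<close> and extends
  continuously to the end point \<open>e\<close>. The norm converges by assumption, and \<open>r\<close> is the product of
  both.\<close>

lemma position_converges:
  assumes S: "is_interval S" "S \<subseteq> einterval a b"
    and away: "\<And>t. t \<in> S \<Longrightarrow> 1 / 2 \<le> norm (r t)"
    and F: "F \<le> at e" "F \<noteq> bot" and ev: "\<forall>\<^sub>F t in F. t \<in> S"
    and lim: "((\<lambda>t. norm (r t)) \<longlongrightarrow> 1) F"
  obtains p where "p \<in> unit_circle" "(r \<longlongrightarrow> p) F"
proof -
  obtain c where c: "\<And>t. t \<in> einterval a b \<Longrightarrow> velocity r t \<bullet> quarter_turn (r t) = c"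
    using angular_momentum_conserved by blast
  have lip: "norm (sgn (r s) - sgn (r t)) \<le> 4 * \<bar>c\<bar> * norm (s - t)" if "s \<in> S" "t \<in> S" for s t
  proof (rule differentiable_bound)
    fix t assume t: "t \<in> S"
    let ?w = "(c / norm (r t) ^ 3) *\<^sub>R quarter_turn (r t)"
    have n: "1 / 2 \<le> norm (r t)" "t \<in> einterval a b"
      using away t S by auto
    then have "((\<lambda>t. sgn (r t)) has_vector_derivative ?w) (at t)"
      using has_derivative_direction[OF n(2)] c[OF n(2)] by force
    then show "((\<lambda>t. sgn (r t)) has_derivative (\<lambda>h. h *\<^sub>R ?w)) (at t within S)"
      using has_derivative_at_withinI unfolding has_vector_derivative_def by blast
    have "norm ?w \<le> (\<bar>c\<bar> / norm (r t) ^ 3) * norm (r t)"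
      using norm_quarter_turn_le[of "r t"] by (simp add: abs_mult mult_left_mono divide_right_mono)
    also have "\<dots> = \<bar>c\<bar> * (1 / norm (r t))\<^sup>2"
      using n by (simp add: power3_eq_cube power2_eq_square)
    also have "\<dots> \<le> \<bar>c\<bar> * 2\<^sup>2"
    proof (intro mult_left_mono power_mono)
      have "0 < norm (r t)"
        using n(1) by linarith
      then show "1 / norm (r t) \<le> 2"
        using n(1) by (simp add: field_simps)
    qed auto
    finally have "norm ?w \<le> 4 * \<bar>c\<bar>"
      by simp
    then have "norm (h *\<^sub>R ?w) \<le> 4 * \<bar>c\<bar> * norm h" for h
      using mult_right_mono[of "norm ?w" "4 * \<bar>c\<bar>" "\<bar>h\<bar>"]
      by (simp only: norm_scaleR[of h ?w] real_norm_def mult.commute[of "\<bar>h\<bar>"] abs_ge_zero)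
    then show "onorm (\<lambda>h. h *\<^sub>R ?w) \<le> 4 * \<bar>c\<bar>"
      by (rule onorm_le)
  qed (use S that in \<open>auto simp: is_interval_convex\<close>)
  have "(4 * \<bar>c\<bar>)-lipschitz_on S (\<lambda>t. sgn (r t))"
    using lip by (intro lipschitz_onI) (auto simp: dist_norm)
  then have uc: "uniformly_continuous_on S (\<lambda>t. sgn (r t))"
    by (rule lipschitz_on_uniformly_continuous)
  have F_S: "F \<le> at e within S"
  proof -
    have "(UNIV - {e}) \<inter> S = S - {e}"
      by blast
    then have "at e within S = inf (at e) (principal S)"
      by (simp only: at_within_def inf_assoc inf_principal)
    then show ?thesis
      using F(1) ev by (simp add: le_principal)
  qed
  then have "at e within S \<noteq> bot"
    using F(2) by (metis bot.extremum_uniqueI)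
  then have "e \<in> closure S"
    by (auto simp: closure_def trivial_limit_within)
  then obtain p where "((\<lambda>t. sgn (r t)) \<longlongrightarrow> p) (at e within S)"
    using uniformly_continuous_on_extension_at_closure[OF uc] by blast
  then have "((\<lambda>t. sgn (r t)) \<longlongrightarrow> p) F"
    by (rule tendsto_mono[OF F_S])
  moreover have "norm x *\<^sub>R sgn x = x" for x :: "real^3"
    by (cases "x = 0") (simp_all add: sgn_div_norm)
  ultimately have p: "(r \<longlongrightarrow> p) F"
    using tendsto_scaleR[OF lim] by fastforce
  have "norm p = 1"
    using tendsto_unique[OF F(2) tendsto_norm[OF p] lim] .
  moreover have "p $ 3 = 0"
  proof (rule tendsto_unique[OF F(2) tendsto_vec_nth[OF p]])
    show "((\<lambda>t. r t $ 3) \<longlongrightarrow> 0) F"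
    proof (rule tendsto_eventually)
      show "\<forall>\<^sub>F t in F. r t $ 3 = 0"
        using ev by eventually_elim (use inside S in \<open>auto simp: xy_plane_def\<close>)
    qed
  qed
  ultimately show ?thesis
    using that p by (simp add: unit_circle_def xy_plane_def)
qed

text \<open>The component of the velocity along the moving direction \<open>quarter_turn (r t)\<close> is the bounded
  angular momentum; replacing that direction by the fixed tangent at \<open>p\<close> costs at most the speed
  times \<open>norm (p - r t)\<close>, which is negligible against the speed.\<close>

lemma velocity_becomes_orthogonal:
  assumes ev: "\<forall>\<^sub>F t in F. t \<in> einterval a b"
    and p: "(r \<longlongrightarrow> p) F"
    and speed: "filterlim (\<lambda>t. norm (velocity r t)) at_top F"
    and tau: "unit_tangent p \<tau>"
  shows "((\<lambda>t. (velocity r t \<bullet> \<tau>) / norm (velocity r t)) \<longlongrightarrow> 0) F"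
proof -
  obtain c where c: "\<And>t. t \<in> einterval a b \<Longrightarrow> velocity r t \<bullet> quarter_turn (r t) = c"
    using angular_momentum_conserved by blast
  obtain \<theta> k where \<theta>: "circ \<theta> = p" "\<tau> = k *\<^sub>R vector_derivative circ (at \<theta>)"
    using tau by (auto simp: unit_tangent_def)
  have "vector_derivative circ (at \<theta>) = quarter_turn p"
    unfolding vector_derivative_at[OF has_vector_derivative_circ] \<theta>(1)[symmetric]
    by (simp add: quarter_turn_def circ_def)
  then have \<tau>: "\<tau> = k *\<^sub>R quarter_turn p"
    using \<theta> by simp
  define B where "B t = \<bar>k\<bar> * (\<bar>c\<bar> / norm (velocity r t) + norm (p - r t))" for t
  have "(B \<longlongrightarrow> \<bar>k\<bar> * (0 + norm (p - p))) F"
    unfolding B_def using speed p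
    by (intro tendsto_intros tendsto_divide_0[OF tendsto_const])
       (auto intro: filterlim_at_top_imp_at_infinity)
  then have B: "(B \<longlongrightarrow> 0) F"
    by simp
  have "\<forall>\<^sub>F t in F. norm ((velocity r t \<bullet> \<tau>) / norm (velocity r t)) \<le> B t"
    using ev filterlim_at_top_dense[THEN iffD1, OF speed, rule_format, of 0]
  proof eventually_elim
    case (elim t)
    let ?v = "velocity r t"
    have "?v \<bullet> quarter_turn p = ?v \<bullet> quarter_turn (r t) + ?v \<bullet> quarter_turn (p - r t)"
      by (simp add: inner_vec3 quarter_turn_def algebra_simps)
    moreover have "\<bar>?v \<bullet> quarter_turn (p - r t)\<bar> \<le> norm ?v * norm (p - r t)"
      by (meson Cauchy_Schwarz_ineq2 mult_left_mono norm_ge_zero norm_quarter_turn_le order_trans)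
    ultimately have "\<bar>?v \<bullet> quarter_turn p\<bar> \<le> \<bar>c\<bar> + norm ?v * norm (p - r t)"
      using c[OF elim(1)] by linarith
    then have "\<bar>k\<bar> * \<bar>?v \<bullet> quarter_turn p\<bar> / norm ?v
        \<le> \<bar>k\<bar> * (\<bar>c\<bar> + norm ?v * norm (p - r t)) / norm ?v"
      by (intro divide_right_mono mult_left_mono) auto
    also have "\<dots> = B t"
      using elim(2) by (simp add: B_def field_simps)
    finally show ?case
      by (simp add: \<tau> abs_mult)
  qed
  then show ?thesis
    using B by (rule Lim_null_comparison)
qed

lemma eventually_near_circle:
  assumes ev: "\<forall>\<^sub>F t in F. t \<in> einterval a b"
    and lim: "((\<lambda>t. norm (r t)) \<longlongrightarrow> 1) F"
  shows "\<forall>\<^sub>F t in F. t \<in> einterval a b \<and> 1 / 2 \<le> norm (r t) \<and> 1 \<le> (r t \<bullet> velocity r t)\<^sup>2"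
proof -
  have "\<forall>\<^sub>F t in F. 1 / 2 < norm (r t)"
    using lim by (rule order_tendstoD) simp
  moreover have "\<forall>\<^sub>F t in F. 1 \<le> (r t \<bullet> velocity r t)\<^sup>2"
    using radial_speed_at_top[OF ev lim] by (simp add: filterlim_at_top)
  ultimately show ?thesis
    using ev by eventually_elim auto
qed

lemma collision:
  assumes S: "is_interval S" "S \<subseteq> einterval a b"
    and away: "\<And>t. t \<in> S \<Longrightarrow> 1 / 2 \<le> norm (r t)"
    and F: "F \<le> at e" "F \<noteq> bot" and ev: "\<forall>\<^sub>F t in F. t \<in> S"
    and lim: "((\<lambda>t. norm (r t)) \<longlongrightarrow> 1) F"
  shows "\<exists>p\<in>unit_circle. (r \<longlongrightarrow> p) F \<and>
     filterlim (\<lambda>t. norm (velocity r t)) at_top F \<and>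
     (\<forall>\<tau>. unit_tangent p \<tau> \<longrightarrow>
        ((\<lambda>t. (velocity r t \<bullet> \<tau>) / norm (velocity r t)) \<longlongrightarrow> 0) F)"
proof -
  obtain p where p: "p \<in> unit_circle" "(r \<longlongrightarrow> p) F"
    using position_converges[OF S away F ev lim] by blast
  have "\<forall>\<^sub>F t in F. t \<in> einterval a b"
    using ev S(2) by (auto elim: eventually_mono)
  then show ?thesis
    using p speed_at_top[OF _ lim] velocity_becomes_orthogonal[OF _ p(2)] by blast
qed

end

section \<open>Collision in finite time\<close>

lemma eventually_to_upper_end_iff:
  assumes "a < b"
  shows "eventually P (to_upper_end b) \<longleftrightarrow> (\<exists>c<b. \<forall>t\<in>einterval c b. P t)"
proof
  assume "eventually P (to_upper_end b)"
  then obtain Q where "eventually Q (at_left b)" and Q: "\<And>t. Q (ereal t) \<Longrightarrow> P t"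
    by (auto simp: to_upper_end_def eventually_filtercomap)
  then have "\<exists>c<b. \<forall>x>c. x < b \<longrightarrow> Q x"
    using eventually_at_left[OF assms] by blast
  then show "\<exists>c<b. \<forall>t\<in>einterval c b. P t"
    using Q by (auto simp: einterval_iff)
next
  assume "\<exists>c<b. \<forall>t\<in>einterval c b. P t"
  then obtain c where c: "c < b" "\<And>t. t \<in> einterval c b \<Longrightarrow> P t"
    by blast
  have "\<forall>\<^sub>F x in at_left b. c < x \<and> x < b"
    using c(1) by (auto simp: eventually_at_left[OF c(1)])
  then show "eventually P (to_upper_end b)"
    using c(2) by (auto simp: to_upper_end_def eventually_filtercomap einterval_iff)
qed

lemma eventually_to_lower_end_iff:
  assumes "a < b"
  shows "eventually P (to_lower_end a) \<longleftrightarrow> (\<exists>c>a. \<forall>t\<in>einterval a c. P t)"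
proof
  assume "eventually P (to_lower_end a)"
  then obtain Q where "eventually Q (at_right a)" and Q: "\<And>t. Q (ereal t) \<Longrightarrow> P t"
    by (auto simp: to_lower_end_def eventually_filtercomap)
  then have "\<exists>c>a. \<forall>x>a. x < c \<longrightarrow> Q x"
    using eventually_at_right[OF assms] by blast
  then show "\<exists>c>a. \<forall>t\<in>einterval a c. P t"
    using Q by (auto simp: einterval_iff)
next
  assume "\<exists>c>a. \<forall>t\<in>einterval a c. P t"
  then obtain c where c: "a < c" "\<And>t. t \<in> einterval a c \<Longrightarrow> P t"
    by blast
  have "\<forall>\<^sub>F x in at_right a. a < x \<and> x < c"
    using c(1) by (auto simp: eventually_at_right[OF c(1)])
  then show "eventually P (to_lower_end a)"
    using c(2) by (auto simp: to_lower_end_def eventually_filtercomap einterval_iff)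
qed

theorem proposition1:
  fixes lam :: real and r :: "real \<Rightarrow> real^3" and a b :: ereal
  assumes "lam > 0"
    and "maximal_solution lam r a b"
    and "\<And>t. t \<in> einterval a b \<Longrightarrow> r t \<in> xy_plane \<and> norm (r t) < 1"
  shows "(((\<lambda>t. infdist (r t) unit_circle) \<longlongrightarrow> 0) (to_upper_end b) \<longrightarrow>
            b < \<infinity> \<and>
            (\<exists>p\<in>unit_circle. (r \<longlongrightarrow> p) (to_upper_end b) \<and>
               filterlim (\<lambda>t. norm (velocity r t)) at_top (to_upper_end b) \<and>
               (\<forall>\<tau>. unit_tangent p \<tau> \<longrightarrow>
                  ((\<lambda>t. (velocity r t \<bullet> \<tau>) / norm (velocity r t)) \<longlongrightarrow> 0) (to_upper_end b)))) \<and>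
         (((\<lambda>t. infdist (r t) unit_circle) \<longlongrightarrow> 0) (to_lower_end a) \<longrightarrow>
            -\<infinity> < a \<and>
            (\<exists>p\<in>unit_circle. (r \<longlongrightarrow> p) (to_lower_end a) \<and>
               filterlim (\<lambda>t. norm (velocity r t)) at_top (to_lower_end a) \<and>
               (\<forall>\<tau>. unit_tangent p \<tau> \<longrightarrow>
                  ((\<lambda>t. (velocity r t \<bullet> \<tau>) / norm (velocity r t)) \<longlongrightarrow> 0) (to_lower_end a))))"
proof -
  have ab: "a < b" and sol: "solution_on lam r a b"
    using assms(2) by (auto simp: maximal_solution_def)
  interpret planar_orbit lam r a b
    using assms(1,3) sol by unfold_locales
  show ?thesis
  proof (intro conjI impI)
    assume "((\<lambda>t. infdist (r t) unit_circle) \<longlongrightarrow> 0) (to_upper_end b)"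
    moreover have ev: "\<forall>\<^sub>F t in to_upper_end b. t \<in> einterval a b"
      using ab eventually_to_upper_end_iff by blast
    ultimately have lim: "((\<lambda>t. norm (r t)) \<longlongrightarrow> 1) (to_upper_end b)"
      by (intro norm_tendsto_1)
    obtain c where c: "c < b" and tail: "\<And>t. t \<in> einterval c b \<Longrightarrow>
        t \<in> einterval a b \<and> 1 / 2 \<le> norm (r t) \<and> 1 \<le> (r t \<bullet> velocity r t)\<^sup>2"
      using eventually_near_circle[OF ev lim] eventually_to_upper_end_iff[OF ab] by auto
    have sub: "einterval c b \<subseteq> einterval a b"
      using tail by blast
    show fin: "b < \<infinity>"
    \<comment> \<open>An infinite tail contains two times at distance 1, although the radial speed is large on it.\<close>
    proof (rule ccontr)
      assume "\<not> b < \<infinity>"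
      moreover obtain t where "t \<in> einterval c b"
        using einterval_nonempty[OF c] by blast
      ultimately have "t \<in> einterval c b" "t + 1 \<in> einterval c b"
        by (auto simp: einterval_iff intro: less_trans)
      then show False
        using short_if_radial_speed_ge_1[OF is_interval_einterval sub, of t "t + 1"] tail by auto
    qed
    with ab obtain \<beta> where \<beta>: "b = ereal \<beta>"
      by (cases b) auto
    show "\<exists>p\<in>unit_circle. (r \<longlongrightarrow> p) (to_upper_end b) \<and>
        filterlim (\<lambda>t. norm (velocity r t)) at_top (to_upper_end b) \<and>
        (\<forall>\<tau>. unit_tangent p \<tau> \<longrightarrow>
          ((\<lambda>t. (velocity r t \<bullet> \<tau>) / norm (velocity r t)) \<longlongrightarrow> 0) (to_upper_end b))"
    proof (rule collision[OF is_interval_einterval sub _ _ _ _ lim])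
      show "to_upper_end b \<le> at \<beta>" "to_upper_end b \<noteq> bot"
        by (simp_all add: \<beta> to_upper_end_ereal at_le)
      show "\<forall>\<^sub>F t in to_upper_end b. t \<in> einterval c b"
        using c eventually_to_upper_end_iff[OF ab] by blast
    qed (use tail in blast)
  next
    assume "((\<lambda>t. infdist (r t) unit_circle) \<longlongrightarrow> 0) (to_lower_end a)"
    moreover have ev: "\<forall>\<^sub>F t in to_lower_end a. t \<in> einterval a b"
      using ab eventually_to_lower_end_iff by blast
    ultimately have lim: "((\<lambda>t. norm (r t)) \<longlongrightarrow> 1) (to_lower_end a)"
      by (intro norm_tendsto_1)
    obtain c where c: "a < c" and tail: "\<And>t. t \<in> einterval a c \<Longrightarrow>
        t \<in> einterval a b \<and> 1 / 2 \<le> norm (r t) \<and> 1 \<le> (r t \<bullet> velocity r t)\<^sup>2"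
      using eventually_near_circle[OF ev lim] eventually_to_lower_end_iff[OF ab] by auto
    have sub: "einterval a c \<subseteq> einterval a b"
      using tail by blast
    show fin: "- \<infinity> < a"
    proof (rule ccontr)
      assume "\<not> - \<infinity> < a"
      moreover obtain t where "t \<in> einterval a c"
        using einterval_nonempty[OF c] by blast
      ultimately have "t \<in> einterval a c" "t - 1 \<in> einterval a c"
        using less_trans[of "ereal (t - 1)" "ereal t" c] by (auto simp: einterval_iff)
      then show False
        using short_if_radial_speed_ge_1[OF is_interval_einterval sub, of "t - 1" t] tail by auto
    qed
    with ab obtain \<alpha> where \<alpha>: "a = ereal \<alpha>"
      by (cases a) auto
    show "\<exists>p\<in>unit_circle. (r \<longlongrightarrow> p) (to_lower_end a) \<and>
        filterlim (\<lambda>t. norm (velocity r t)) at_top (to_lower_end a) \<and>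
        (\<forall>\<tau>. unit_tangent p \<tau> \<longrightarrow>
          ((\<lambda>t. (velocity r t \<bullet> \<tau>) / norm (velocity r t)) \<longlongrightarrow> 0) (to_lower_end a))"
    proof (rule collision[OF is_interval_einterval sub _ _ _ _ lim])
      show "to_lower_end a \<le> at \<alpha>" "to_lower_end a \<noteq> bot"
        by (simp_all add: \<alpha> to_lower_end_ereal at_le)
      show "\<forall>\<^sub>F t in to_lower_end a. t \<in> einterval a c"
        using c eventually_to_lower_end_iff[OF ab] by blast
    qed (use tail in blast)
  qed
qed

end
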